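(* There exist infinitely many (pairwise non-isomorphic) multigraphs $G$ with $\chi_c'(G) = 5+\frac{3}{4}$, $\Delta(G)=5$, and edge connectivity $1$.
   Context: Multigraphs are finite and loopless; parallel edges are allowed. $\Delta(G)$ denotes the maximum degree of $G$ (parallel edges counted with multiplicity). For a real number $r$, a circular $r$-edge-colouring of $G$ is a map $c$ assigning to each edge of $G$ a real number in $[0,r)$ such that any two distinct edges $e,f$ sharing at least one end-vertex (in particular, any two parallel edges) satisfy $1\le |c(e)-c(f)|\le r-1$. The circular chromatic index $\chi_c'(G)$ is the infimum (attained for finite multigraphs) of all $r$ such that $G$ admits a circular $r$-edge-colouring. *)

theory Defs
  imports Complex_Main
begin

text \<open>
  A multigraph has named edges; parallel edges are distinct edge names with the same set of
  end-vertices. Looplessness is the requirement that every edge has exactly two end-vertices.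
  The values of \<open>ends\<close> outside \<open>edges\<close> are irrelevant.
\<close>

record ('v, 'e) multigraph =
  verts :: "'v set"
  edges :: "'e set"
  ends :: "'e \<Rightarrow> 'v set"

definition is_multigraph :: "('v, 'e) multigraph \<Rightarrow> bool" where
  "is_multigraph G \<longleftrightarrow> finite (verts G) \<and> finite (edges G) \<and>
     (\<forall>e\<in>edges G. ends G e \<subseteq> verts G \<and> card (ends G e) = 2)"

definition isomorphic :: "('v, 'e) multigraph \<Rightarrow> ('w, 'f) multigraph \<Rightarrow> bool" where
  "isomorphic G H \<longleftrightarrow> (\<exists>\<phi> \<psi>. bij_betw \<phi> (verts G) (verts H) \<and> bij_betw \<psi> (edges G) (edges H) \<and>
     (\<forall>e\<in>edges G. ends H (\<psi> e) = \<phi> ` ends G e))"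

definition degree :: "('v, 'e) multigraph \<Rightarrow> 'v \<Rightarrow> nat" where
  "degree G v = card {e \<in> edges G. v \<in> ends G e}"

text \<open>Unspecified for the multigraph without vertices.\<close>

definition max_degree :: "('v, 'e) multigraph \<Rightarrow> nat" where
  "max_degree G = Max (degree G ` verts G)"

definition adjacency :: "('v, 'e) multigraph \<Rightarrow> ('v \<times> 'v) set" where
  "adjacency G = {(u, v). u \<noteq> v \<and> (\<exists>e\<in>edges G. ends G e = {u, v})}"

definition connected_multigraph :: "('v, 'e) multigraph \<Rightarrow> bool" where
  "connected_multigraph G \<longleftrightarrow> verts G \<noteq> {} \<and> (\<forall>u\<in>verts G. \<forall>v\<in>verts G. (u, v) \<in> (adjacency G)\<^sup>*)"

definition delete_edges :: "('v, 'e) multigraph \<Rightarrow> 'e set \<Rightarrow> ('v, 'e) multigraph" where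
  "delete_edges G F = G\<lparr>edges := edges G - F\<rparr>"

text \<open>
  The least number of edges whose deletion leaves a disconnected multigraph. A multigraph with
  at most one vertex cannot be disconnected in this way and gets the conventional value \<open>0\<close>.
\<close>

definition edge_connectivity :: "('v, 'e) multigraph \<Rightarrow> nat" where
  "edge_connectivity G =
     (if card (verts G) \<le> 1 then 0
      else (LEAST k. \<exists>F\<subseteq>edges G. card F = k \<and> \<not> connected_multigraph (delete_edges G F)))"

definition circular_edge_colouring :: "('v, 'e) multigraph \<Rightarrow> real \<Rightarrow> ('e \<Rightarrow> real) \<Rightarrow> bool" where
  "circular_edge_colouring G r c \<longleftrightarrow>
     (\<forall>e\<in>edges G. 0 \<le> c e \<and> c e < r) \<and>
     (\<forall>e\<in>edges G. \<forall>f\<in>edges G. e \<noteq> f \<and> ends G e \<inter> ends G f \<noteq> {} \<longrightarrow>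
        1 \<le> \<bar>c e - c f\<bar> \<and> \<bar>c e - c f\<bar> \<le> r - 1)"

text \<open>
  For a multigraph with an edge the set below is bounded below by \<open>0\<close>, so the real infimum is
  the intended one; for an edgeless multigraph it is all of \<open>\<real>\<close> and the value is unspecified.
\<close>

definition circular_chromatic_index :: "('v, 'e) multigraph \<Rightarrow> real" where
  "circular_chromatic_index G = Inf {r. \<exists>c. circular_edge_colouring G r c}"

end

theory Submission
  imports Defs
begin

text \<open>
  Take the fat triangle with multiplicities 2, 2, 3. Replace the vertex opposite the triple edge by
  a triangle \<open>A B D\<close> with multiplicities 2, 2, 1, and replace one of the three parallel edges,
  which join \<open>C\<close> and \<open>E\<close>, by a chain containing three 4-fold edges. Finally attach a path of
  arbitrary length at \<open>A\<close>; this gives infinitely many graphs with a bridge.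

  In a circular \<open>r\<close>-edge-colouring with \<open>r = 5 + \<epsilon>\<close> and \<open>\<epsilon> < 1\<close>, the colours of the two edges that
  continue a 4-fold edge differ by at most \<open>\<epsilon>\<close> around the circle, so the first and last edge of the
  chain differ by at most \<open>3\<epsilon>\<close>. On the other hand the triangle \<open>A B D\<close> acts as a vertex with some
  slack: with the colour of \<open>B D\<close> at 0, the edges leaving to \<open>C\<close> and \<open>E\<close> have colours within
  \<open>\<epsilon>\<close> above 1, 2, 3, 4. The two remaining parallel edges are then pushed next to 0, and the ends of
  the chain are at least \<open>3 - \<epsilon>\<close> apart. Hence \<open>3 - \<epsilon> \<le> 3\<epsilon>\<close>, and equality can be realised.
\<close>

section \<open>Circular distance and the colours around the core\<close>

text \<open>For representatives in \<open>[0, r)\<close>: distance at least 1 on the circle of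
  circumference \<open>r\<close>.\<close>

definition far :: "real \<Rightarrow> real \<Rightarrow> real \<Rightarrow> bool" where
  "far r x y \<longleftrightarrow> 1 \<le> \<bar>x - y\<bar> \<and> \<bar>x - y\<bar> \<le> r - 1"

lemma far_less: "far r x y \<Longrightarrow> x + 1 \<le> y \<or> y + 1 \<le> x"
  by (auto simp: far_def abs_if split: if_splits)

lemma far_zero: "far r 0 t \<Longrightarrow> 0 \<le> t \<Longrightarrow> 1 \<le> t \<and> t \<le> r - 1"
  by (auto simp: far_def)

text \<open>
  In the next lemmas \<open>p, p'\<close> colour the edges \<open>A B\<close>, \<open>q, q'\<close> the edges \<open>A D\<close>, and 0 the edge
  \<open>B D\<close>; \<open>b, b'\<close> and \<open>d, d'\<close> colour the edges from \<open>B\<close> and \<open>D\<close> to \<open>C\<close> and \<open>E\<close>, sorted by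
  colour; \<open>x, y\<close> colour the two remaining edges \<open>C E\<close>, and \<open>c, e\<close> the ends of the chain that
  meet \<open>b, b'\<close>, while \<open>u, u'\<close> are \<open>d, d'\<close> in the order in which they meet \<open>c, e\<close>.
  The three alternatives are the possible interleavings of the \<open>p\<close>s and the \<open>q\<close>s.
\<close>

lemma triangle_slots:
  fixes r p p' q q' b b' d d' :: real
  assumes r: "r < 6"
    and cl: "sorted_wrt (far r) [p, p', q, q']" "sorted_wrt (far r) [0, p, p', b, b']"
      "sorted_wrt (far r) [0, q, q', d, d']"
    and pos: "\<forall>t\<in>{p, p', q, q', b, b', d, d'}. 0 \<le> t"
    and ord: "p < p'" "q < q'" "p < q" "b < b'" "d < d'"
  shows "d \<in> {1..r - 4} \<and>
     (d' \<in> {2..r - 3} \<and> b \<in> {3..r - 2} \<and> b' \<in> {4..r - 1} \<or>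
      b \<in> {2..r - 3} \<and> d' \<in> {3..r - 2} \<and> b' \<in> {4..r - 1} \<and> d + 2 \<le> d' \<and> b + 2 \<le> b' \<or>
      b \<in> {2..r - 3} \<and> b' \<in> {3..r - 2} \<and> d' \<in> {4..r - 1} \<and> d + 3 \<le> d')"
proof -
  have lo': "1 \<le> p" "1 \<le> q" "1 \<le> b" "1 \<le> d" "p' \<le> r - 1" "q' \<le> r - 1" "b' \<le> r - 1" "d' \<le> r - 1"
    using cl pos by (simp_all add: far_zero[of r])
  have s: "p + 1 \<le> p'" "q + 1 \<le> q'" "b + 1 \<le> b'" "d + 1 \<le> d'" "p + 1 \<le> q"
    using far_less[of r p p'] far_less[of r q q'] far_less[of r b b'] far_less[of r d d'] far_less[of r p q] ord cl
    by simp_all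
  have f: "p' + 1 \<le> q \<or> q + 1 \<le> p'" "p' + 1 \<le> q' \<or> q' + 1 \<le> p'"
     "p + 1 \<le> b \<or> b + 1 \<le> p" "p + 1 \<le> b' \<or> b' + 1 \<le> p" "p' + 1 \<le> b \<or> b + 1 \<le> p'" "p' + 1 \<le> b' \<or> b' + 1 \<le> p'"
     "q + 1 \<le> d \<or> d + 1 \<le> q" "q + 1 \<le> d' \<or> d' + 1 \<le> q" "q' + 1 \<le> d \<or> d + 1 \<le> q'" "q' + 1 \<le> d' \<or> d' + 1 \<le> q'"
    using cl by (simp_all add: far_less[of r])
  \<comment> \<open>The four nonzero colours at \<open>B\<close> lie within \<open>r - 5\<close>
    above 1, 2, 3, 4, and so do those at \<open>D\<close>. The \<open>p\<close>s and
    \<open>q\<close>s also share these four slots, so \<open>b, b'\<close> get the slots of the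
    \<open>q\<close>s and \<open>d, d'\<close> those of the \<open>p\<close>s.\<close>
  consider (1) "p' + 1 \<le> q" | (2) "q + 1 \<le> p'" "p' + 1 \<le> q'" | (3) "q' + 1 \<le> p'"
    using f(1,2) s by linarith
  then show ?thesis
  proof cases
    case 1
    have "p + 1 \<le> b" using f(3) 1 r lo' s by linarith
    moreover have "p' + 1 \<le> b" using f(5) 1 r lo' s calculation by linarith
    moreover have "d + 1 \<le> q" using f(7) 1 r lo' s by linarith
    moreover have "d' + 1 \<le> q" using f(8,10) 1 r lo' s by linarith
    ultimately have "1 \<le> d" "d \<le> r - 4" "2 \<le> d'" "d' \<le> r - 3" "3 \<le> b" "b \<le> r - 2" "4 \<le> b'" "b' \<le> r - 1"
      using 1 r lo' s by linarith+
    then show ?thesis by simp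
  next
    case 2
    have "p + 1 \<le> b" using f(3) 2 r lo' s by linarith
    moreover have "b + 1 \<le> p'" using f(5) 2 r lo' s by linarith
    moreover have "p' + 1 \<le> b'" using f(6) 2 r lo' s calculation by linarith
    moreover have "d + 1 \<le> q" using f(7,9,10) 2 r lo' s by linarith
    moreover have "q + 1 \<le> d'" using f(8) 2 r lo' s calculation by linarith
    moreover have "d' + 1 \<le> q'" using f(10) 2 r lo' s calculation by linarith
    ultimately have "1 \<le> d" "d \<le> r - 4" "2 \<le> b" "b \<le> r - 3" "3 \<le> d'" "d' \<le> r - 2" "4 \<le> b'" "b' \<le> r - 1" "d + 2 \<le> d'" "b + 2 \<le> b'"
      using 2 r lo' s by linarith+
    then show ?thesis by simp
  next
    case 3
    have "p + 1 \<le> b" using f(3) 3 r lo' s by linarith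
    moreover have "b' + 1 \<le> p'" using f(5,6) 3 r lo' s calculation by linarith
    moreover have "d + 1 \<le> q" using f(7,9,10) 3 r lo' s by linarith
    moreover have "q + 1 \<le> d'" using f(8) 3 r lo' s calculation by linarith
    moreover have "q' + 1 \<le> d'" using f(10) 3 r lo' s calculation by linarith
    ultimately have "1 \<le> d" "d \<le> r - 4" "2 \<le> b" "b \<le> r - 3" "3 \<le> b'" "b' \<le> r - 2" "4 \<le> d'" "d' \<le> r - 1" "d + 3 \<le> d'"
      using 3 r lo' s by linarith+
    then show ?thesis by simp
  qed
qed

lemma far_sym: "far r x y \<longleftrightarrow> far r y x"
  by (auto simp: far_def abs_minus_commute)

text \<open>Consecutive \<open>w\<close>s differ by at most \<open>r - 4 < 2\<close>, so no colour
  fits between them. Below \<open>w1\<close> and above \<open>w4\<close> the room is shorter than 1,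
  hence each side takes just one of \<open>x\<close> and \<open>y\<close>.\<close>

lemma parallel_pair_window:
  assumes r: "r < 6"
    and w: "w1 \<in> {1..r - 4}" "w2 \<in> {2..r - 3}" "w3 \<in> {3..r - 2}" "w4 \<in> {4..r - 1}"
    and f: "\<forall>w\<in>{w1, w2, w3, w4}. far r x w \<and> far r y w" and xy: "far r x y" "y < x"
    and dom: "0 \<le> y" "x < r"
  shows "y + 1 \<le> w1" "w4 + 1 \<le> x" "x - y \<le> r - 1"
proof -
  have "y + 1 \<le> x" "x - y \<le> r - 1" using xy unfolding far_def by linarith+
  moreover have "x + 1 \<le> w1 \<or> w1 + 1 \<le> x" "x + 1 \<le> w2 \<or> w2 + 1 \<le> x" "x + 1 \<le> w3 \<or> w3 + 1 \<le> x" "x + 1 \<le> w4 \<or> w4 + 1 \<le> x"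
     "y + 1 \<le> w1 \<or> w1 + 1 \<le> y" "y + 1 \<le> w2 \<or> w2 + 1 \<le> y" "y + 1 \<le> w3 \<or> w3 + 1 \<le> y" "y + 1 \<le> w4 \<or> w4 + 1 \<le> y"
    using f by (simp_all add: far_less[of r])
  ultimately show "y + 1 \<le> w1" "w4 + 1 \<le> x" "x - y \<le> r - 1"
    using r w dom unfolding atLeastAtMost_iff by (smt (verit))+
qed

text \<open>Only the first interleaving with \<open>u = d\<close> survives. Otherwise the window
  bounds fail or a chain of gaps from \<open>y\<close> up to \<open>x\<close> adds up to at least 5,
  against \<open>x - y \<le> r - 1\<close>.\<close>

lemma core_gap_sorted:
  fixes r p p' q q' b b' d d' x y c e u u' :: real
  assumes r: "r < 23 / 4"
    and cl: "sorted_wrt (far r) [p, p', q, q']" "sorted_wrt (far r) [0, p, p', b, b']"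
      "sorted_wrt (far r) [0, q, q', d, d']"
      "sorted_wrt (far r) [x, y, b, u, c]" "sorted_wrt (far r) [x, y, b', u', e]"
    and dom: "\<forall>t\<in>{p, p', q, q', b, b', d, d', x, y, c, e}. 0 \<le> t \<and> t < r"
    and ord: "p < p'" "q < q'" "p < q" "b < b'" "d < d'" "y < x"
    and u: "u = d \<and> u' = d' \<or> u = d' \<and> u' = d"
  shows "8 - r \<le> \<bar>c - e\<bar> \<and> \<bar>c - e\<bar> \<le> r - 3"
proof -
  have f: "\<forall>w\<in>{b, b', d, d'}. far r x w \<and> far r y w" and xy: "far r x y"
    using cl u by auto
  have s: "b + 1 \<le> b'" "d + 1 \<le> d'"
    using far_less[of r b b'] far_less[of r d d'] ord cl by simp_all
  have ce: "x + 1 \<le> c \<or> c + 1 \<le> x" "y + 1 \<le> c \<or> c + 1 \<le> y" "b + 1 \<le> c \<or> c + 1 \<le> b" "u + 1 \<le> c \<or> c + 1 \<le> u"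
    "x + 1 \<le> e \<or> e + 1 \<le> x" "y + 1 \<le> e \<or> e + 1 \<le> y" "b' + 1 \<le> e \<or> e + 1 \<le> b'" "u' + 1 \<le> e \<or> e + 1 \<le> u'"
    "b + 1 \<le> u \<or> u + 1 \<le> b" "b' + 1 \<le> u' \<or> u' + 1 \<le> b'"
    using cl by (simp_all add: far_less[of r])
  have dom': "0 \<le> y" "x < r" "0 \<le> c" "c < r" "0 \<le> e" "e < r" using dom by auto
  have d: "d \<in> {1..r - 4}" and
   "(d' \<in> {2..r - 3} \<and> b \<in> {3..r - 2} \<and> b' \<in> {4..r - 1} \<or>
      b \<in> {2..r - 3} \<and> d' \<in> {3..r - 2} \<and> b' \<in> {4..r - 1} \<and> d + 2 \<le> d' \<and> b + 2 \<le> b' \<or>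
      b \<in> {2..r - 3} \<and> b' \<in> {3..r - 2} \<and> d' \<in> {4..r - 1} \<and> d + 3 \<le> d')"
    using triangle_slots[OF _ cl(1-3) _ ord(1-5)] r dom by auto
  then consider (1) "d' \<in> {2..r - 3}" "b \<in> {3..r - 2}" "b' \<in> {4..r - 1}"
    | (2) "b \<in> {2..r - 3}" "d' \<in> {3..r - 2}" "b' \<in> {4..r - 1}" "d + 2 \<le> d'" "b + 2 \<le> b'"
    | (3) "b \<in> {2..r - 3}" "b' \<in> {3..r - 2}" "d' \<in> {4..r - 1}" "d + 3 \<le> d'"
    by blast
  then show ?thesis
  proof cases
    case 1
    have w: "y + 1 \<le> d" "b' + 1 \<le> x" "x - y \<le> r - 1"
      using parallel_pair_window[OF _ d 1(1-3) _ xy] f r ord dom' by auto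
    show ?thesis using u
    proof
      assume "u = d \<and> u' = d'"
      then have ce': "d + 1 \<le> c \<or> c + 1 \<le> d" "d' + 1 \<le> e \<or> e + 1 \<le> d'" using ce(4,8) by simp_all
      note w' = 1[unfolded atLeastAtMost_iff] d[unfolded atLeastAtMost_iff] w dom' s r
      \<comment> \<open>\<open>c\<close> is forced above \<open>b\<close>, so
        \<open>c \<ge> 4\<close>, and \<open>e\<close> below \<open>d'\<close>, so
        \<open>e \<le> r - 4\<close>. Both lie in \<open>[y + 1, x - 1]\<close>, which bounds the
        difference by \<open>r - 3\<close>.\<close>
      have "y + 1 \<le> c" "c + 1 \<le> x" "y + 1 \<le> e" "e + 1 \<le> x"
        using ce(1) ce(2) ce(5) ce(6) w' by linarith+
      moreover have "d + 1 \<le> c" using ce'(1) w' calculation by linarith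
      moreover have "b + 1 \<le> c" using ce(3) w' calculation by linarith
      moreover have "e + 1 \<le> b'" using ce(7) w' calculation by linarith
      moreover have "e + 1 \<le> d'" using ce'(2) w' calculation by linarith
      ultimately show ?thesis using w' by linarith
    next
      assume "u = d' \<and> u' = d"
      then have "d' + 1 \<le> b \<or> b + 1 \<le> d'" using ce(9) by auto
      with 1 d w s r show ?thesis unfolding atLeastAtMost_iff by linarith
    qed
  next
    case 2
    have w: "y + 1 \<le> d" "b' + 1 \<le> x" "x - y \<le> r - 1"
      using parallel_pair_window[OF _ d 2(1-3) _ xy] f r ord dom' by auto
    show ?thesis using u
    proof
      assume "u = d \<and> u' = d'"
      then have "d + 1 \<le> b \<or> b + 1 \<le> d" using ce(9) by auto
      with 2 d w s r show ?thesis unfolding atLeastAtMost_iff by linarith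
    next
      assume "u = d' \<and> u' = d"
      then have ce': "d' + 1 \<le> c \<or> c + 1 \<le> d'" using ce(4) by simp
      note w' = 2[unfolded atLeastAtMost_iff] d[unfolded atLeastAtMost_iff] w dom' s r
      \<comment> \<open>No place is left for \<open>c\<close>: below \<open>b\<close> the chain
        \<open>y, c, b, b', x\<close> and above \<open>d'\<close> the chain
        \<open>y, d, d', c, x\<close> have gaps summing to 5, and \<open>b\<close> and
        \<open>d'\<close> are less than 2 apart.\<close>
      have "y + 1 \<le> c" "c + 1 \<le> x" using ce(1) ce(2) w' by linarith+
      moreover have "b + 1 \<le> c" using ce(3) w' calculation by linarith
      ultimately show ?thesis using ce' w' by linarith
    qed
  next
    case 3
    have w: "y + 1 \<le> d" "d' + 1 \<le> x" "x - y \<le> r - 1"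
      using parallel_pair_window[OF _ d 3(1-3) _ xy] f r ord dom' by auto
    with 3 r show ?thesis by auto
  qed
qed

section \<open>Passing a 4-fold edge\<close>

lemma four_reals_sorted:
  fixes S :: "real set"
  assumes "card S = 4"
  obtains a b c d where "S = {a, b, c, d}" "a < b" "b < c" "c < d"
proof -
  have fin: "finite S" using assms card.infinite by fastforce
  define xs where "xs = sorted_list_of_set S"
  have "length xs = 4" using assms fin by (simp add: xs_def)
  then obtain a b c d where e: "xs = [a, b, c, d]"
    by (auto simp: numeral_eq_Suc length_Suc_conv)
  have "sorted_wrt (<) xs" by (simp add: xs_def)
  then show ?thesis using that[of a b c d] e set_sorted_list_of_set[OF fin] unfolding xs_def by auto
qed

text \<open>For representatives in \<open>[0, r)\<close>: circular distance at most
  \<open>s\<close>, the second disjunct being the way around through 0.\<close>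

definition near :: "real \<Rightarrow> real \<Rightarrow> real \<Rightarrow> real \<Rightarrow> bool" where
  "near r s x y \<longleftrightarrow> \<bar>x - y\<bar> \<le> s \<or> r - s \<le> \<bar>x - y\<bar>"

lemma near_trans:
  assumes "near r s x y" "near r t y z" "{x, y, z} \<subseteq> {0..<r}" "0 \<le> s" "0 \<le> t"
  shows "near r (s + t) x z"
  using assms by (auto simp: near_def abs_if split: if_splits)

text \<open>The four colours cut the circle into arcs of length at least 1, and \<open>x\<close> and
  \<open>y\<close> each need an arc of length at least 2. Two such arcs would require
  \<open>r \<ge> 6\<close>, so both lie in one arc of length at most \<open>r - 3\<close>, at
  distance 1 from its ends.\<close>

lemma near_across_four:
  assumes r: "r < 6" and S: "card S = 4" "pairwise (far r) S" "S \<subseteq> {0..<r}"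
    and xy: "{x, y} \<subseteq> {0..<r}" "\<And>u. u \<in> S \<Longrightarrow> far r u x" "\<And>u. u \<in> S \<Longrightarrow> far r u y"
  shows "near r (r - 5) x y"
proof -
  obtain a b c d where e: "S = {a, b, c, d}" "a < b" "b < c" "c < d"
    using four_reals_sorted S(1) by blast
  have "far r a b" "far r b c" "far r c d" "far r a d"
    using S(2) e by (auto simp: pairwise_def)
  then have "a + 1 \<le> b" "b + 1 \<le> c" "c + 1 \<le> d" "d - a \<le> r - 1"
    using e by (auto simp: far_def)
  moreover have "a + 1 \<le> x \<or> x + 1 \<le> a" "b + 1 \<le> x \<or> x + 1 \<le> b" "c + 1 \<le> x \<or> x + 1 \<le> c" "d + 1 \<le> x \<or> x + 1 \<le> d"
    "a + 1 \<le> y \<or> y + 1 \<le> a" "b + 1 \<le> y \<or> y + 1 \<le> b" "c + 1 \<le> y \<or> y + 1 \<le> c" "d + 1 \<le> y \<or> y + 1 \<le> d"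
    using xy e by (simp_all add: far_less[of r])
  moreover have "\<bar>a - x\<bar> \<le> r - 1" "\<bar>d - x\<bar> \<le> r - 1" "\<bar>a - y\<bar> \<le> r - 1" "\<bar>d - y\<bar> \<le> r - 1"
    using xy e by (simp_all add: far_def)
  ultimately show ?thesis
    using r unfolding near_def by (smt (verit))
qed

section \<open>The core without ordering assumptions\<close>

lemma far_irrefl [simp]: "\<not> far r x x"
  by (simp add: far_def)

text \<open>The order assumptions of \<open>core_gap_sorted\<close> are reached by exchanging
  parallel edges, \<open>B\<close> with \<open>D\<close>, and \<open>C\<close> with
  \<open>E\<close>. The orders of the \<open>b\<close>s and of the \<open>d\<close>s may disagree;
  the two alternatives for \<open>u, u'\<close> account for this.\<close>

lemma core_gap:
  fixes r p p' q q' b\<^sub>1 b\<^sub>2 d\<^sub>1 d\<^sub>2 x y c e :: real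
  assumes r: "r < 23 / 4"
    and cl: "sorted_wrt (far r) [p, p', q, q']" "sorted_wrt (far r) [0, p, p', b\<^sub>1, b\<^sub>2]"
      "sorted_wrt (far r) [0, q, q', d\<^sub>1, d\<^sub>2]"
      "sorted_wrt (far r) [x, y, b\<^sub>1, d\<^sub>1, c]" "sorted_wrt (far r) [x, y, b\<^sub>2, d\<^sub>2, e]"
    and dom: "\<forall>t\<in>{p, p', q, q', b\<^sub>1, b\<^sub>2, d\<^sub>1, d\<^sub>2, x, y, c, e}. 0 \<le> t \<and> t < r"
  shows "8 - r \<le> \<bar>c - e\<bar> \<and> \<bar>c - e\<bar> \<le> r - 3"
proof -
  define gap where "gap c e \<longleftrightarrow> 8 - r \<le> \<bar>c - e\<bar> \<and> \<bar>c - e\<bar> \<le> r - 3" for c e :: real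
  have gap_sym: "gap c e \<longleftrightarrow> gap e c" for c e
    by (simp add: gap_def abs_minus_commute)
  note core = core_gap_sorted[OF r, folded gap_def]
  have by_order: "gap c e"
    if "sorted_wrt (far r) [p, p', q, q']" "sorted_wrt (far r) [0, p, p', b\<^sub>1, b\<^sub>2]"
      "sorted_wrt (far r) [0, q, q', d\<^sub>1, d\<^sub>2]"
      "sorted_wrt (far r) [x, y, b\<^sub>1, d\<^sub>1, c]" "sorted_wrt (far r) [x, y, b\<^sub>2, d\<^sub>2, e]"
      "\<forall>t\<in>{p, p', q, q', b\<^sub>1, b\<^sub>2, d\<^sub>1, d\<^sub>2, x, y, c, e}. 0 \<le> t \<and> t < r"
      "p < p'" "q < q'" "y < x" "p < q" for p p' q q' b\<^sub>1 b\<^sub>2 d\<^sub>1 d\<^sub>2 x y c e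
  proof -
    have "b\<^sub>1 \<noteq> b\<^sub>2" "d\<^sub>1 \<noteq> d\<^sub>2" using that by auto
    then consider "b\<^sub>1 < b\<^sub>2" "d\<^sub>1 < d\<^sub>2" | "b\<^sub>1 < b\<^sub>2" "d\<^sub>2 < d\<^sub>1" | "b\<^sub>2 < b\<^sub>1" "d\<^sub>1 < d\<^sub>2" | "b\<^sub>2 < b\<^sub>1" "d\<^sub>2 < d\<^sub>1"
      by linarith
    then show ?thesis
    proof cases
      case 1
      then show ?thesis
        using that core[of p p' q q' b\<^sub>1 b\<^sub>2 d\<^sub>1 d\<^sub>2 x y d\<^sub>1 c d\<^sub>2 e] by simp
    next
      case 2
      then show ?thesis
        using that core[of p p' q q' b\<^sub>1 b\<^sub>2 d\<^sub>2 d\<^sub>1 x y d\<^sub>1 c d\<^sub>2 e] by (simp add: far_sym)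
    next
      case 3
      then show ?thesis
        using that core[of p p' q q' b\<^sub>2 b\<^sub>1 d\<^sub>1 d\<^sub>2 x y d\<^sub>2 e d\<^sub>1 c] by (simp add: far_sym gap_sym)
    next
      case 4
      then show ?thesis
        using that core[of p p' q q' b\<^sub>2 b\<^sub>1 d\<^sub>2 d\<^sub>1 x y d\<^sub>2 e d\<^sub>1 c] by (simp add: far_sym gap_sym)
    qed
  qed
  have by_side: "gap c e"
    if "sorted_wrt (far r) [p, p', q, q']" "sorted_wrt (far r) [0, p, p', b\<^sub>1, b\<^sub>2]"
      "sorted_wrt (far r) [0, q, q', d\<^sub>1, d\<^sub>2]"
      "sorted_wrt (far r) [x, y, b\<^sub>1, d\<^sub>1, c]" "sorted_wrt (far r) [x, y, b\<^sub>2, d\<^sub>2, e]"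
      "\<forall>t\<in>{p, p', q, q', b\<^sub>1, b\<^sub>2, d\<^sub>1, d\<^sub>2, x, y, c, e}. 0 \<le> t \<and> t < r"
      "p < p'" "q < q'" "y < x" for p p' q q' x y
  proof -
    have ne: "p \<noteq> q" using that by auto
    show ?thesis
    proof (cases "p < q")
      case True
      then show ?thesis by (rule by_order[OF that])
    next
      case False
      with ne have "q < p" by simp
      then show ?thesis
        using that by (intro by_order[of q q' p p' d\<^sub>1 d\<^sub>2 b\<^sub>1 b\<^sub>2 x y c e]) (simp_all add: far_sym)
    qed
  qed
  have ne: "p \<noteq> p'" "q \<noteq> q'" "x \<noteq> y" using cl by auto
  have by_pairs: "gap c e"
    if "y < x" "sorted_wrt (far r) [x, y, b\<^sub>1, d\<^sub>1, c]" "sorted_wrt (far r) [x, y, b\<^sub>2, d\<^sub>2, e]"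
      "\<forall>t\<in>{x, y}. 0 \<le> t \<and> t < r" for x y
  proof -
    consider "p < p'" "q < q'" | "p < p'" "q' < q" | "p' < p" "q < q'" | "p' < p" "q' < q"
      using ne by linarith
    then show ?thesis
    proof cases
      case 1
      then show ?thesis using that cl dom by (intro by_side[of p p' q q' x y]) simp_all
    next
      case 2
      then show ?thesis using that cl dom by (intro by_side[of p p' q' q x y]) (simp_all add: far_sym)
    next
      case 3
      then show ?thesis using that cl dom by (intro by_side[of p' p q q' x y]) (simp_all add: far_sym)
    next
      case 4
      then show ?thesis using that cl dom by (intro by_side[of p' p q' q x y]) (simp_all add: far_sym)
    qed
  qed
  show ?thesis unfolding gap_def[symmetric]
  proof (cases "y < x")
    case True
    then show "gap c e" using cl dom by (intro by_pairs[of y x]) simp_all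
  next
    case False
    with ne have "x < y" by simp
    then show "gap c e" using cl dom by (intro by_pairs[of x y]) (simp_all add: far_sym)
  qed
qed

section \<open>The graphs and the lower bound\<close>

text \<open>Rotating the circle preserves circular distances. This gives \<open>B D\<close> the
  colour 0 that \<open>core_gap\<close> expects.\<close>

lemma circular_edge_colouring_rotate:
  assumes "circular_edge_colouring G r c" "e\<^sub>0 \<in> edges G"
  obtains c' where "circular_edge_colouring G r c'" "c' e\<^sub>0 = 0"
proof -
  define c' where "c' e = (if c e\<^sub>0 \<le> c e then c e - c e\<^sub>0 else c e - c e\<^sub>0 + r)" for e
  have "c' e\<^sub>0 = 0" by (simp add: c'_def)
  have dom: "0 \<le> c e" "c e < r" if "e \<in> edges G" for e
    using assms that by (auto simp: circular_edge_colouring_def)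
  have "0 \<le> c' e \<and> c' e < r" if "e \<in> edges G" for e
    using dom[OF that] dom[OF assms(2)] by (auto simp: c'_def)
  moreover have "1 \<le> \<bar>c' e - c' f\<bar> \<and> \<bar>c' e - c' f\<bar> \<le> r - 1"
    if "1 \<le> \<bar>c e - c f\<bar> \<and> \<bar>c e - c f\<bar> \<le> r - 1" "e \<in> edges G" "f \<in> edges G" for e f
    using that dom[of e] dom[of f] dom[OF assms(2)] unfolding c'_def by (cases "c e\<^sub>0 \<le> c e"; cases "c e\<^sub>0 \<le> c f"; cases "c e \<le> c f") simp_all
  ultimately have "circular_edge_colouring G r c'"
    using assms(1) unfolding circular_edge_colouring_def by blast
  with \<open>c' e\<^sub>0 = 0\<close> show ?thesis using that by blast
qed

text \<open>
  The vertices \<open>B, D, C, E, A\<close> are 0, 1, 2, 3, 10, the chain runs through 4 to 9, and the attached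
  path is 10, 11, 12, and so on. Edge 0 is \<open>B D\<close>, and edge 27 is the bridge at \<open>A\<close>.
\<close>

definition core_ends :: "(nat \<times> nat) list" where
  "core_ends = [(0, 1), (0, 10), (0, 10), (1, 10), (1, 10), (0, 2), (0, 3), (1, 2), (1, 3),
     (2, 3), (2, 3), (2, 4), (4, 5), (4, 5), (4, 5), (4, 5), (5, 6), (6, 7), (6, 7), (6, 7), (6, 7),
     (7, 8), (8, 9), (8, 9), (8, 9), (8, 9), (9, 3)]"

definition tailed :: "nat \<Rightarrow> (nat, nat) multigraph" where
  "tailed n = \<lparr>verts = {..<12 + n}, edges = {..<28 + n},
     ends = (\<lambda>e. if e < 27 then {fst (core_ends ! e), snd (core_ends ! e)} else {e - 17, e - 16})\<rparr>"

lemma tailed_simps [simp]: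
  "verts (tailed n) = {..<12 + n}"
  "edges (tailed n) = {..<28 + n}"
  "ends (tailed n) e = (if e < 27 then {fst (core_ends ! e), snd (core_ends ! e)} else {e - 17, e - 16})"
  by (simp_all add: tailed_def)

lemma circular_edge_colouring_incident:
  assumes "circular_edge_colouring G r c"
    and "distinct es" "\<forall>e\<in>set es. e \<in> edges G \<and> v \<in> ends G e"
  shows "sorted_wrt (far r) (map c es)"
  using assms(2,3)
proof (induction es)
  case (Cons e es)
  have "far r (c e) (c f)" if "f \<in> set es" for f
    using assms(1) Cons.prems that unfolding circular_edge_colouring_def far_def by fastforce
  with Cons show ?case by simp
qed simp

text \<open>Each of \<open>e\<close> and \<open>f\<close> meets all four parallel edges at one of
  their ends; the four colours are distinct because \<open>far\<close> is irreflexive.\<close>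

lemma near_across_four_parallel:
  assumes "circular_edge_colouring G r c" "r < 6"
    and "distinct es" "length es = 4" "{u, v} \<subseteq> \<Inter> (ends G ` set es)"
      "u \<in> ends G e" "v \<in> ends G f" "insert e (insert f (set es)) \<subseteq> edges G" "e \<notin> set es" "f \<notin> set es"
  shows "near r (r - 5) (c e) (c f)"
proof -
  have adj: "far r (c g) (c h)" if "g \<in> edges G" "h \<in> edges G" "g \<noteq> h" "ends G g \<inter> ends G h \<noteq> {}" for g h
    using assms(1) that unfolding circular_edge_colouring_def far_def by blast
  have es: "set es \<subseteq> edges G" "e \<in> edges G" "f \<in> edges G"
    using assms(8) by auto
  have uv: "u \<in> ends G g" "v \<in> ends G g" if "g \<in> set es" for g
    using assms(5) that by auto
  have dom: "c g \<in> {0..<r}" if "g \<in> edges G" for g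
    using assms(1) that by (simp add: circular_edge_colouring_def)
  have pw: "far r (c g) (c h)" if "g \<in> set es" "h \<in> set es" "g \<noteq> h" for g h
    using that es uv[of g] uv[of h] by (intro adj) auto
  have "inj_on c (set es)"
  proof (rule inj_onI)
    fix g h assume "g \<in> set es" "h \<in> set es" "c g = c h"
    then show "g = h" using pw[of g h] by (cases "g = h") simp_all
  qed
  then have "card (c ` set es) = 4"
    using assms(3,4) by (simp add: card_image distinct_card)
  moreover have "pairwise (far r) (c ` set es)"
    using pw by (auto simp: pairwise_def)
  moreover have "c ` set es \<subseteq> {0..<r}" "{c e, c f} \<subseteq> {0..<r}"
    using dom es by blast+
  moreover have "far r (c g) (c e)" "far r (c g) (c f)" if "g \<in> set es" for g
    using that es uv[of g] assms(6,7,9,10) by (auto intro!: adj)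
  then have "\<And>t. t \<in> c ` set es \<Longrightarrow> far r t (c e)" "\<And>t. t \<in> c ` set es \<Longrightarrow> far r t (c f)"
    by auto
  ultimately show ?thesis
    by (rule near_across_four[OF assms(2)])
qed

lemma tailed_lower_bound:
  assumes "circular_edge_colouring (tailed n) r c"
  shows "23 / 4 \<le> r"
proof (rule ccontr)
  assume "\<not> 23 / 4 \<le> r"
  then have r: "r < 23 / 4" by simp
  obtain c where c: "circular_edge_colouring (tailed n) r c" "c 0 = 0"
    using circular_edge_colouring_rotate[OF assms, of 0] by auto
  note inc = circular_edge_colouring_incident[OF c(1)]
  have dom: "0 \<le> c i \<and> c i < r" if "i < 28" for i
    using c(1) that unfolding circular_edge_colouring_def by auto
  \<comment> \<open>The lists are the edges at \<open>A\<close> (without the bridge),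
    \<open>B\<close>, \<open>D\<close>, \<open>C\<close> and \<open>E\<close>, in the order in which
    \<open>core_gap\<close> takes them.\<close>
  have "sorted_wrt (far r) (map c [1, 2, 3, 4])"
    by (rule inc[where v = 10]) (simp_all add: core_ends_def)
  moreover have "sorted_wrt (far r) (map c [0, 1, 2, 5, 6])"
    by (rule inc[where v = 0]) (simp_all add: core_ends_def)
  moreover have "sorted_wrt (far r) (map c [0, 3, 4, 7, 8])"
    by (rule inc[where v = 1]) (simp_all add: core_ends_def)
  moreover have "sorted_wrt (far r) (map c [9, 10, 5, 7, 11])"
    by (rule inc[where v = 2]) (simp_all add: core_ends_def)
  moreover have "sorted_wrt (far r) (map c [9, 10, 6, 8, 26])"
    by (rule inc[where v = 3]) (simp_all add: core_ends_def)
  ultimately have gap: "8 - r \<le> \<bar>c 11 - c 26\<bar> \<and> \<bar>c 11 - c 26\<bar> \<le> r - 3"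
    unfolding list.map c(2) by (rule core_gap[OF r]) (simp add: dom)
  note across = near_across_four_parallel[OF c(1)]
  have "near r (r - 5) (c 11) (c 16)"
    using r by (intro across[of "[12, 13, 14, 15]" 4 5]) (simp_all add: core_ends_def)
  moreover have "near r (r - 5) (c 16) (c 21)"
    using r by (intro across[of "[17, 18, 19, 20]" 6 7]) (simp_all add: core_ends_def)
  moreover have "near r (r - 5) (c 21) (c 26)"
    using r by (intro across[of "[22, 23, 24, 25]" 8 9]) (simp_all add: core_ends_def)
  \<comment> \<open>From \<open>8 - r \<le> r - 3\<close>; the tolerance \<open>r - 5\<close> must
    be nonnegative for \<open>near_trans\<close>.\<close>
  moreover have "5 \<le> r" using gap by linarith
  ultimately have "near r (r - 5 + (r - 5) + (r - 5)) (c 11) (c 26)"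
    using dom by (intro near_trans[where y = "c 21"] near_trans[where y = "c 16"]) auto
  \<comment> \<open>The chain makes the difference at most \<open>3 * r - 15\<close> or at least
    \<open>15 - 2 * r\<close>. Against the gap, the first gives \<open>r \<ge> 23 / 4\<close> and
    the second \<open>r \<ge> 6\<close>.\<close>
  with gap r show False
    unfolding near_def by linarith
qed

section \<open>An optimal colouring\<close>

text \<open>Colours are given in units of \<open>1/4\<close>, so that they live in the integers modulo 23.\<close>

definition core_colours :: "nat list" where
  "core_colours = [0, 4, 8, 15, 19, 12, 16, 5, 11, 20, 1, 16, 1, 5, 9, 20, 13, 17, 21, 2, 6,
     10, 14, 18, 22, 3, 7]"

text \<open>The edges 1 to 4 at \<open>A\<close> have colours 4, 8, 15, 19, which leaves 0 free for
  the bridge 27; from there the path alternates between 0 and 8.\<close>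

definition tailed_colour :: "nat \<Rightarrow> nat" where
  "tailed_colour e = (if e < 27 then core_colours ! e else if even e then 8 else 0)"

text \<open>In quarter units, 4 is the distance 1 and 19 is \<open>r - 1\<close> for
  \<open>r = 23 / 4\<close>. The pair \<open>(10, 11)\<close> stands for the bridge, the only path
  edge that meets the core.\<close>

lemma core_colours_far:
  "\<forall>e\<in>set [0..<28]. \<forall>f\<in>set [0..<28]. e < f \<longrightarrow> e < 27 \<longrightarrow>
     (let (u, v) = core_ends ! e; (u', v') = (if f < 27 then core_ends ! f else (10, 11)) in
       u = u' \<or> u = v' \<or> v = u' \<or> v = v') \<longrightarrow>
     (let a = tailed_colour e; b = tailed_colour f in (a + 4 \<le> b \<and> b \<le> a + 19) \<or> (b + 4 \<le> a \<and> a \<le> b + 19))"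
  by code_simp

lemma core_ends_bounds:
  assumes "e < 27"
  shows "fst (core_ends ! e) \<le> 10" "snd (core_ends ! e) \<le> 10"
    "fst (core_ends ! e) \<noteq> snd (core_ends ! e)"
proof -
  have "\<forall>e\<in>set [0..<27]. fst (core_ends ! e) \<le> 10 \<and> snd (core_ends ! e) \<le> 10 \<and>
      fst (core_ends ! e) \<noteq> snd (core_ends ! e)"
    by code_simp
  then show "fst (core_ends ! e) \<le> 10" "snd (core_ends ! e) \<le> 10"
    "fst (core_ends ! e) \<noteq> snd (core_ends ! e)"
    using assms by simp_all
qed

lemma core_colours_less: "\<forall>e\<in>set [0..<27]. core_colours ! e < 23"
  by code_simp

lemma tailed_colour_far:
  assumes "e < f" "ends (tailed n) e \<inter> ends (tailed n) f \<noteq> {}"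
  defines "a \<equiv> tailed_colour e" and "b \<equiv> tailed_colour f"
  shows "(a + 4 \<le> b \<and> b \<le> a + 19) \<or> (b + 4 \<le> a \<and> a \<le> b + 19)"
proof (cases "e < 27")
  case True
  have "f < 28"
  proof (rule ccontr)
    assume "\<not> f < 28"
    then have "ends (tailed n) f = {f - 17, f - 16}" "11 \<le> f - 17" "11 \<le> f - 16" by auto
    with core_ends_bounds[OF True] True assms(2) show False by auto
  qed
  have meet: "let (u, v) = core_ends ! e; (u', v') = (if f < 27 then core_ends ! f else (10, 11)) in
       u = u' \<or> u = v' \<or> v = u' \<or> v = v'"
  proof (cases "f < 27")
    case False
    with \<open>f < 28\<close> have "f = 27" by simp
    with True assms(2) show ?thesis by (auto simp: Let_def split_beta)
  next
    case f: True
    with True assms(2) show ?thesis by (auto simp: Let_def split_beta)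
  qed
  have "e \<in> set [0..<28]" "f \<in> set [0..<28]" using True \<open>f < 28\<close> by simp_all
  from core_colours_far[rule_format, OF this assms(1) True meet] show ?thesis
    by (simp add: a_def b_def Let_def)
next
  case False
  \<comment> \<open>Path edges meet only if consecutive, and then their parities, hence their
    colours, differ.\<close>
  with assms(1,2) have "f = Suc e" by auto
  with False show ?thesis by (simp add: a_def b_def tailed_colour_def)
qed

lemma tailed_colouring:
  "circular_edge_colouring (tailed n) (23 / 4) (\<lambda>e. real (tailed_colour e) / 4)"
proof -
  have "tailed_colour e < 23" for e
    using core_colours_less by (simp add: tailed_colour_def)
  then have "real (tailed_colour e) < 23" for e
    by (metis of_nat_less_iff of_nat_numeral)
  moreover have "1 \<le> \<bar>real (tailed_colour e) / 4 - real (tailed_colour f) / 4\<bar> \<and>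
      \<bar>real (tailed_colour e) / 4 - real (tailed_colour f) / 4\<bar> \<le> 23 / 4 - 1"
    if "e \<noteq> f" "ends (tailed n) e \<inter> ends (tailed n) f \<noteq> {}" for e f
  proof -
    define a b where "a = tailed_colour e" and "b = tailed_colour f"
    have "(a + 4 \<le> b \<and> b \<le> a + 19) \<or> (b + 4 \<le> a \<and> a \<le> b + 19)"
      unfolding a_def b_def
      using tailed_colour_far[of e f n] tailed_colour_far[of f e n] that by (metis Int_commute linorder_neqE_nat)
    then have "1 \<le> \<bar>real a / 4 - real b / 4\<bar> \<and> \<bar>real a / 4 - real b / 4\<bar> \<le> 23 / 4 - 1"
      by (auto simp: abs_if)
    then show ?thesis unfolding a_def b_def .
  qed
  ultimately show ?thesis
    unfolding circular_edge_colouring_def by simp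
qed

lemma circular_chromatic_index_tailed: "circular_chromatic_index (tailed n) = 23 / 4"
  unfolding circular_chromatic_index_def
  by (rule cInf_eq_minimum) (use tailed_colouring tailed_lower_bound in blast)+

section \<open>Degrees and edge connectivity\<close>

lemma is_multigraph_tailed: "is_multigraph (tailed n)"
proof -
  have "ends (tailed n) e \<subseteq> verts (tailed n) \<and> card (ends (tailed n) e) = 2" if "e \<in> edges (tailed n)" for e
  proof (cases "e < 27")
    case True
    with core_ends_bounds[OF True] show ?thesis by simp
  next
    case False
    with that have "e - 17 \<noteq> e - 16" "e - 16 < 12 + n" "e - 17 < 12 + n" by auto
    with False show ?thesis by simp
  qed
  then show ?thesis by (simp add: is_multigraph_def)
qed

text \<open>Vertex 10 is one short of 5 here; the bridge makes up the difference.\<close>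

lemma core_degrees:
  "\<forall>v\<in>set [0..<11]. length (filter (\<lambda>e. v = fst (core_ends ! e) \<or> v = snd (core_ends ! e)) [0..<27])
     = (if v = 10 then 4 else 5)"
  by code_simp

lemma degree_tailed:
  "degree (tailed n) v \<le> 5" "degree (tailed n) 10 = 5"
proof -
  have core: "card {e. e < 27 \<and> v \<in> ends (tailed n) e} = (if v = 10 then 4 else 5)" if "v < 11" for v
  proof -
    have "{e. e < 27 \<and> v \<in> ends (tailed n) e} =
        set (filter (\<lambda>e. v = fst (core_ends ! e) \<or> v = snd (core_ends ! e)) [0..<27])"
      by auto
    then show ?thesis
      using core_degrees that by (simp only: distinct_card distinct_filter distinct_upt) simp
  qed
  have split: "{e \<in> edges (tailed n). v \<in> ends (tailed n) e} =
      {e. e < 27 \<and> v \<in> ends (tailed n) e} \<union> {e. 27 \<le> e \<and> e < 28 + n \<and> (v = e - 17 \<or> v = e - 16)}" for v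
    by auto
  have "{e. 27 \<le> e \<and> e < 28 + n \<and> (10 = e - 17 \<or> 10 = e - 16)} = {27}" by auto
  moreover have "{e. e < 27 \<and> 10 \<in> ends (tailed n) e} \<inter> {27} = {}" by auto
  ultimately show deg10: "degree (tailed n) 10 = 5"
    unfolding degree_def split using core[of 10] by (subst card_Un_disjoint) simp_all
  show "degree (tailed n) v \<le> 5"
  proof -
    consider "v < 10" | "v = 10" | "10 < v" by linarith
    then show ?thesis
    proof cases
      case 1
      then have none: "{e. 27 \<le> e \<and> e < 28 + n \<and> (v = e - 17 \<or> v = e - 16)} = {}" by auto
      show ?thesis
        using 1 core[of v] unfolding degree_def split none by simp
    next
      case 2
      then show ?thesis using deg10 by simp
    next
      case 3
      have "{e \<in> edges (tailed n). v \<in> ends (tailed n) e} \<subseteq> {v + 16, v + 17}"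
      proof
        fix e assume e: "e \<in> {e \<in> edges (tailed n). v \<in> ends (tailed n) e}"
        have "\<not> e < 27" using e 3 core_ends_bounds(1,2)[of e] by auto
        with e show "e \<in> {v + 16, v + 17}" by auto
      qed
      then have "degree (tailed n) v \<le> card {v + 16, v + 17}"
        unfolding degree_def by (rule card_mono[rotated]) simp
      then show ?thesis by simp
    qed
  qed
qed

lemma max_degree_tailed: "max_degree (tailed n) = 5"
  unfolding max_degree_def
proof (rule Max_eqI)
  show "5 \<in> degree (tailed n) ` verts (tailed n)"
    by (rule image_eqI[where x = 10]) (simp_all add: degree_tailed(2))
qed (use degree_tailed(1) in auto)

text \<open>Every vertex except 0 has a smaller neighbour, so descent always ends at 0.\<close>

lemma connected_multigraph_tailed: "connected_multigraph (tailed n)"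
proof -
  let ?R = "adjacency (tailed n)"
  have sym: "sym ?R"
    by (auto simp: sym_def adjacency_def insert_commute)
  have core: "(fst (core_ends ! e), snd (core_ends ! e)) \<in> ?R" if "e < 27" for e
    unfolding adjacency_def using that core_ends_bounds(3)[OF that] by (auto intro: bexI[of _ e])
  have down: "\<exists>u<v. (v, u) \<in> ?R" if "0 < v" "v < 12 + n" for v
  proof (cases "v < 11")
    case True
    \<comment> \<open>Entry \<open>v\<close> is an edge from \<open>v\<close> to a smaller vertex;
      entry 0 is a placeholder.\<close>
    define es where "es = [0, 0, 5, 6, 11, 12, 16, 17, 21, 22, 1 :: nat]"
    have "\<forall>v\<in>set [1..<11]. es ! v < 27 \<and> fst (core_ends ! (es ! v)) < v \<and> snd (core_ends ! (es ! v)) = v"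
      unfolding es_def by code_simp
    with True that have "es ! v < 27" "fst (core_ends ! (es ! v)) < v" "snd (core_ends ! (es ! v)) = v"
      by auto
    with core[of "es ! v"] sym show ?thesis by (metis symD)
  next
    case False
    with that have "(v - 1, v) \<in> ?R"
      unfolding adjacency_def by (auto intro!: bexI[of _ "v + 16"])
    with False sym show ?thesis by (intro exI[of _ "v - 1"]) (auto dest: symD)
  qed
  have "(v, 0) \<in> ?R\<^sup>*" if "v < 12 + n" for v
    using that
  proof (induction v rule: less_induct)
    case (less v)
    show ?case
    proof (cases "v = 0")
      case False
      then obtain u where "u < v" "(v, u) \<in> ?R" using down less.prems by auto
      with less show ?thesis by (meson converse_rtrancl_into_rtrancl less_trans)
    qed simp
  qed
  moreover have "sym (?R\<^sup>*)" using sym by (rule sym_rtrancl)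
  ultimately have "(u, v) \<in> ?R\<^sup>*" if "u < 12 + n" "v < 12 + n" for u v
    using that by (meson rtrancl_trans symD)
  moreover have "0 \<in> verts (tailed n)" by simp
  then have "verts (tailed n) \<noteq> {}" by blast
  ultimately show ?thesis
    unfolding connected_multigraph_def by simp
qed

text \<open>Apart from edge 27, no edge joins a vertex up to 10 to a larger one, so 11 cannot be
  reached from 0.\<close>

lemma not_connected_tailed: "\<not> connected_multigraph (delete_edges (tailed n) {27})"
proof
  let ?H = "delete_edges (tailed n) {27}"
  assume "connected_multigraph ?H"
  then have "(0, 11) \<in> (adjacency ?H)\<^sup>*"
    by (simp add: connected_multigraph_def delete_edges_def)
  moreover have "v \<le> 10" if "(0, v) \<in> (adjacency ?H)\<^sup>*" for v
    using that
  proof (induction rule: rtrancl_induct)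
    case (step u v)
    then obtain e where e: "e \<noteq> 27" "{u, v} = ends (tailed n) e"
      by (auto simp: adjacency_def delete_edges_def)
    have "e < 27"
    proof (rule ccontr)
      assume "\<not> e < 27"
      with e have "{u, v} = {e - 17, e - 16}" "11 \<le> e - 17" by auto
      with step.IH show False by (auto simp: doubleton_eq_iff)
    qed
    with core_ends_bounds[OF this] e show ?case by (auto simp: doubleton_eq_iff)
  qed simp
  ultimately show False by fastforce
qed

lemma edge_connectivity_tailed: "edge_connectivity (tailed n) = 1"
proof -
  have "(LEAST k. \<exists>F\<subseteq>edges (tailed n). card F = k \<and> \<not> connected_multigraph (delete_edges (tailed n) F)) = 1"
  proof (rule Least_equality)
    show "\<exists>F\<subseteq>edges (tailed n). card F = 1 \<and> \<not> connected_multigraph (delete_edges (tailed n) F)"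
      using not_connected_tailed by (intro exI[of _ "{27}"]) simp
  next
    fix k
    assume "\<exists>F\<subseteq>edges (tailed n). card F = k \<and> \<not> connected_multigraph (delete_edges (tailed n) F)"
    then obtain F where F: "F \<subseteq> edges (tailed n)" "card F = k"
      "\<not> connected_multigraph (delete_edges (tailed n) F)" by blast
    have "F \<noteq> {}"
      using F(3) connected_multigraph_tailed[of n] by (auto simp: delete_edges_def simp del: tailed_simps)
    moreover have "finite F" using F(1) finite_subset by fastforce
    ultimately show "1 \<le> k" using F(2) by (metis One_nat_def Suc_leI card_gt_0_iff)
  qed
  then show ?thesis by (simp add: edge_connectivity_def)
qed

theorem theorem4:
  "\<exists>\<G> :: (nat, nat) multigraph set.
     infinite \<G> \<and>
     pairwise (\<lambda>G H. \<not> isomorphic G H) \<G> \<and>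
     (\<forall>G\<in>\<G>. is_multigraph G \<and>
        circular_chromatic_index G = 5 + 3 / 4 \<and>
        max_degree G = 5 \<and>
        edge_connectivity G = 1)"
proof (intro exI conjI)
  have non_iso: "\<not> isomorphic (tailed m) (tailed n)" if "m \<noteq> n" for m n
  proof
    assume "isomorphic (tailed m) (tailed n)"
    then obtain \<phi> where "bij_betw \<phi> {..<12 + m} {..<12 + n}"
      by (auto simp: isomorphic_def)
    \<comment> \<open>The invariant that separates the graphs is the number of vertices.\<close>
    from bij_betw_same_card[OF this] that show False by simp
  qed
  have "inj tailed"
  proof (rule injI)
    fix m n assume "tailed m = tailed n"
    then have "verts (tailed m) = verts (tailed n)" by simp
    then show "m = n" by simp
  qed
  then show "infinite (range tailed)"
    by (simp add: finite_image_iff)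
  show "pairwise (\<lambda>G H. \<not> isomorphic G H) (range tailed)"
  proof (rule pairwiseI)
    fix G H assume "G \<in> range tailed" "H \<in> range tailed" "G \<noteq> H"
    then obtain m n where "G = tailed m" "H = tailed n" "m \<noteq> n" by auto
    with non_iso show "\<not> isomorphic G H" by simp
  qed
  show "\<forall>G\<in>range tailed. is_multigraph G \<and> circular_chromatic_index G = 5 + 3 / 4 \<and>
      max_degree G = 5 \<and> edge_connectivity G = 1"
    using is_multigraph_tailed circular_chromatic_index_tailed max_degree_tailed edge_connectivity_tailed
    by auto
qed

end
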